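(* When $P=O(1)$, FCFS is $O(1)$-competitive for minimizing the $\ell_2$ norm of flow time: for every $K\ge1$ there is a constant $C_K$ such that every instance with $P\le K$ satisfies $\sqrt{F(\mathcal{FCFS})}\le C_K\sqrt{F(\mathcal{OPT})}$.
   Context: A single machine and $n$ jobs; job $J_i$ has integer release time $r_i\ge0$ and integer processing time $p_i\ge1$. Unit slots $[t]=[t,t+1)$; a (preemptive) schedule assigns each slot to at most one job so that $J_i$ receives exactly $p_i$ slots, all with $t\ge r_i$. $c_i(\mathcal{S})$ is the completion time of $J_i$, $f_i(\mathcal{S})=c_i(\mathcal{S})-r_i$, $F(\mathcal{S})=\sum_i f_i(\mathcal{S})^2$, the $\ell_2$ norm of flow time is $\sqrt{F(\mathcal{S})}$, and $\mathcal{OPT}$ minimizes $F$. $P=\max_i p_i/\min_i p_i$. $\mathcal{FCFS}$ is the First-Come-First-Served schedule: jobs are processed non-preemptively in order of non-decreasing release time, never idling while some released job is unfinished. *)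

theory Defs
  imports Complex_Main
begin

text \<open>An instance has jobs \<open>0, \<dots>, n - 1\<close>, release times \<open>r\<close> and processing times \<open>p\<close>.
  It has at least one job, since the ratio of the extreme processing times is meaningless otherwise.\<close>

definition valid_instance :: "nat \<Rightarrow> (nat \<Rightarrow> nat) \<Rightarrow> bool" where
  "valid_instance n p \<longleftrightarrow> n \<ge> 1 \<and> (\<forall>i<n. p i \<ge> 1)"

definition proc_ratio :: "nat \<Rightarrow> (nat \<Rightarrow> nat) \<Rightarrow> real" where
  "proc_ratio n p = real (Max (p ` {..<n})) / real (Min (p ` {..<n}))"

text \<open>A schedule maps the slot \<open>[t, t + 1)\<close> to the job run in it, or to \<open>None\<close> if the machine idles.\<close>

type_synonym schedule = "nat \<Rightarrow> nat option"

definition slots :: "schedule \<Rightarrow> nat \<Rightarrow> nat set" where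
  "slots S i = {t. S t = Some i}"

text \<open>As \<open>p i \<ge> 1\<close>, the cardinality condition also forces \<open>slots S i\<close> to be finite and nonempty.\<close>

definition feasible :: "nat \<Rightarrow> (nat \<Rightarrow> nat) \<Rightarrow> (nat \<Rightarrow> nat) \<Rightarrow> schedule \<Rightarrow> bool" where
  "feasible n r p S \<longleftrightarrow>
     (\<forall>t i. S t = Some i \<longrightarrow> i < n \<and> r i \<le> t) \<and> (\<forall>i<n. card (slots S i) = p i)"

text \<open>A job completes at the end of the last slot it receives.\<close>

definition completion :: "schedule \<Rightarrow> nat \<Rightarrow> nat" where
  "completion S i = Max (slots S i) + 1"

definition flow :: "(nat \<Rightarrow> nat) \<Rightarrow> schedule \<Rightarrow> nat \<Rightarrow> real" where
  "flow r S i = real (completion S i) - real (r i)"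

definition sq_flow :: "nat \<Rightarrow> (nat \<Rightarrow> nat) \<Rightarrow> schedule \<Rightarrow> real" where
  "sq_flow n r S = (\<Sum>i<n. (flow r S i)\<^sup>2)"

definition optimal :: "nat \<Rightarrow> (nat \<Rightarrow> nat) \<Rightarrow> (nat \<Rightarrow> nat) \<Rightarrow> schedule \<Rightarrow> bool" where
  "optimal n r p S \<longleftrightarrow> is_arg_min (sq_flow n r) (feasible n r p) S"

text \<open>First-Come-First-Served: every job runs in consecutive slots, jobs released earlier run
  before jobs released later (the order among simultaneously released jobs is arbitrary), and no
  slot is idle while some job is released and not yet completed.\<close>

definition fcfs :: "nat \<Rightarrow> (nat \<Rightarrow> nat) \<Rightarrow> (nat \<Rightarrow> nat) \<Rightarrow> schedule \<Rightarrow> bool" where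
  "fcfs n r p S \<longleftrightarrow>
     feasible n r p S \<and>
     (\<forall>i<n. \<exists>s. slots S i = {s..<s + p i}) \<and>
     (\<forall>i<n. \<forall>j<n. r i < r j \<longrightarrow> (\<forall>t\<in>slots S i. \<forall>u\<in>slots S j. t < u)) \<and>
     (\<forall>t. S t = None \<longrightarrow> \<not> (\<exists>i<n. r i \<le> t \<and> t < completion S i))"

text \<open>The remaining facts show that optimal and First-Come-First-Served schedules exist for every
  valid instance.\<close>

lemma fcfs_exists_aux:
  fixes r p :: "nat \<Rightarrow> nat"
  assumes "finite J"
  shows "\<exists>S. (\<forall>t i. S t = Some i \<longrightarrow> i \<in> J \<and> r i \<le> t) \<and>
           (\<forall>i\<in>J. \<exists>s. slots S i = {s..<s + p i}) \<and>
           (\<forall>i\<in>J. \<forall>j\<in>J. r i < r j \<longrightarrow> (\<forall>t\<in>slots S i. \<forall>u\<in>slots S j. t < u)) \<and>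
           (\<forall>t. S t = None \<longrightarrow> (\<forall>i\<in>J. r i \<le> t \<longrightarrow> (\<forall>u\<in>slots S i. u < t)))"
  using assms
proof (induction J rule: finite_ranking_induct[where f = r])
  case empty
  show ?case by (rule exI[of _ "\<lambda>_. None"]) auto
next
  case (insert x J)
  show ?case
  proof (cases "x \<in> J")
    case True
    then show ?thesis using insert.IH by (simp add: insert_absorb)
  next
    case False
    obtain S where S:
      "\<forall>t i. S t = Some i \<longrightarrow> i \<in> J \<and> r i \<le> t"
      "\<forall>i\<in>J. \<exists>s. slots S i = {s..<s + p i}"
      "\<forall>i\<in>J. \<forall>j\<in>J. r i < r j \<longrightarrow> (\<forall>t\<in>slots S i. \<forall>u\<in>slots S j. t < u)"
      "\<forall>t. S t = None \<longrightarrow> (\<forall>i\<in>J. r i \<le> t \<longrightarrow> (\<forall>u\<in>slots S i. u < t))"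
      using insert.IH by (elim exE conjE)
    have S1: "i \<in> J \<and> r i \<le> t" if "S t = Some i" for t i using S(1) that by blast
    have S2: "\<exists>s. slots S i = {s..<s + p i}" if "i \<in> J" for i using S(2) that by blast
    have S3: "t < u" if "i \<in> J" "j \<in> J" "r i < r j" "t \<in> slots S i" "u \<in> slots S j" for i j t u
      using S(3) that by blast
    have S4: "u < t" if "S t = None" "i \<in> J" "r i \<le> t" "u \<in> slots S i" for t i u
      using S(4) that by blast
    have "finite (\<Union>i\<in>J. slots S i)"
    proof (rule finite_UN_I[OF insert.hyps(1)])
      fix i assume "i \<in> J"
      then show "finite (slots S i)" using S2[of i] by auto
    qed
    then obtain b where b: "\<And>t. t \<in> (\<Union>i\<in>J. slots S i) \<Longrightarrow> t < b"
      unfolding finite_nat_set_iff_bounded by blast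
    have b': "S t = None" if "t \<ge> b" for t
    proof (cases "S t")
      case (Some i)
      then have "t < b" using b[of t] S1[OF Some] by (auto simp: slots_def)
      then show ?thesis using that by simp
    qed simp
    define Q where "Q m \<longleftrightarrow> r x \<le> m \<and> (\<forall>t\<ge>m. S t = None)" for m
    define m where "m = (LEAST m. Q m)"
    have "Q (max b (r x))" using b' by (auto simp: Q_def)
    then have Qm: "Q m" unfolding m_def by (rule LeastI)
    have min: "\<not> Q k" if "k < m" for k using that not_less_Least unfolding m_def by blast
    have busy: "S t \<noteq> None" if t: "r x \<le> t" "t < m" for t
    proof
      assume None: "S t = None"
      from min[OF t(2)] t(1) obtain u where u: "t \<le> u" "S u \<noteq> None" by (auto simp: Q_def)
      then obtain j where j: "S u = Some j" by auto
      have "j \<in> J" using S1[OF j] by simp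
      moreover have "r j \<le> t" using insert.hyps(2)[OF \<open>j \<in> J\<close>] t(1) by simp
      moreover have "u \<in> slots S j" using j by (simp add: slots_def)
      ultimately show False using S4[OF None] u(1) by (meson leD)
    qed
    define T where "T t = (if m \<le> t \<and> t < m + p x then Some x else S t)" for t
    have noneS: "S t = None" if "m \<le> t" for t using Qm that by (simp add: Q_def)
    have rx: "r x \<le> m" using Qm by (simp add: Q_def)
    have Tx: "slots T x = {m..<m + p x}"
      using S1 False by (auto simp: slots_def T_def)
    have TJ: "slots T i = slots S i" if "i \<in> J" for i
      using that False noneS by (auto simp: slots_def T_def)
    have before: "t < m" if "t \<in> slots S i" for t i
      using that noneS[of t] by (cases "m \<le> t") (auto simp: slots_def)
    show ?thesis
    proof (intro exI[of _ T] conjI)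
      show "\<forall>t i. T t = Some i \<longrightarrow> i \<in> insert x J \<and> r i \<le> t"
        using S1 rx by (auto simp: T_def split: if_splits)
      show "\<forall>i\<in>insert x J. \<exists>s. slots T i = {s..<s + p i}"
        using S2 Tx TJ by auto
      show "\<forall>i\<in>insert x J. \<forall>j\<in>insert x J. r i < r j \<longrightarrow> (\<forall>t\<in>slots T i. \<forall>u\<in>slots T j. t < u)"
      proof (intro ballI impI)
        fix i j t u
        assume *: "i \<in> insert x J" "j \<in> insert x J" "r i < r j" "t \<in> slots T i" "u \<in> slots T j"
        have "i \<in> J" using *(1-3) insert.hyps(2)[of j] by auto
        show "t < u"
        proof (cases "j = x")
          case True
          then show ?thesis using before[of t i] * \<open>i \<in> J\<close> TJ Tx by fastforce
        next
          case False
          then show ?thesis using S3[of i j t u] * \<open>i \<in> J\<close> TJ by auto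
        qed
      qed
      show "\<forall>t. T t = None \<longrightarrow> (\<forall>i\<in>insert x J. r i \<le> t \<longrightarrow> (\<forall>u\<in>slots T i. u < t))"
      proof (intro allI impI ballI)
        fix t i u
        assume *: "T t = None" "i \<in> insert x J" "r i \<le> t" "u \<in> slots T i"
        have St: "S t = None" "\<not> (m \<le> t \<and> t < m + p x)"
          using *(1) by (auto simp: T_def split: if_splits)
        show "u < t"
        proof (cases "i = x")
          case True
          then have "\<not> t < m" using busy[of t] St * by auto
          then show ?thesis using St(2) *(4) Tx True by auto
        next
          case False
          then show ?thesis using S4[OF St(1)] * TJ by auto
        qed
      qed
    qed
  qed
qed

lemma fcfs_exists:
  assumes "valid_instance n p"
  shows "\<exists>S. fcfs n r p S"
proof -
  obtain S where
    S: "\<forall>t i. S t = Some i \<longrightarrow> i \<in> {..<n} \<and> r i \<le> t"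
       "\<forall>i\<in>{..<n}. \<exists>s. slots S i = {s..<s + p i}"
       "\<forall>i\<in>{..<n}. \<forall>j\<in>{..<n}. r i < r j \<longrightarrow> (\<forall>t\<in>slots S i. \<forall>u\<in>slots S j. t < u)"
       "\<forall>t. S t = None \<longrightarrow> (\<forall>i\<in>{..<n}. r i \<le> t \<longrightarrow> (\<forall>u\<in>slots S i. u < t))"
    using fcfs_exists_aux[OF finite_lessThan, of n r p] by (elim exE conjE)
  have card: "card (slots S i) = p i" if "i < n" for i
    using S(2) that by (metis add_diff_cancel_left' card_atLeastLessThan lessThan_iff)
  have "\<not> t < completion S i" if "S t = None" "i < n" "r i \<le> t" for t i
  proof -
    have "card (slots S i) > 0" using card[OF that(2)] assms that(2) by (fastforce simp: valid_instance_def)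
    then have "Max (slots S i) \<in> slots S i" by (intro Max_in) (auto simp: card_gt_0_iff)
    then have "Max (slots S i) < t" using S(4)[rule_format, of t i] that by simp
    then show ?thesis by (simp add: completion_def)
  qed
  note busy = this
  have "fcfs n r p S"
    unfolding fcfs_def
  proof (intro conjI allI impI notI)
    show "feasible n r p S"
      using S(1) card by (simp add: feasible_def)
    show "\<exists>s. slots S i = {s..<s + p i}" if "i < n" for i
      using bspec[OF S(2), of i] that by (simp only: lessThan_iff)
    show "\<forall>t\<in>slots S i. \<forall>u\<in>slots S j. t < u" if "i < n" "j < n" "r i < r j" for i j
      by (rule mp[OF bspec[OF bspec[OF S(3)]]]) (use that in \<open>simp_all only: lessThan_iff\<close>)
    show False if "S t = None" "\<exists>i<n. r i \<le> t \<and> t < completion S i" for t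
      using busy that by metis
  qed
  then show ?thesis by blast
qed

lemma optimal_exists:
  assumes "valid_instance n p"
  shows "\<exists>S. optimal n r p S"
proof -
  define g where "g S = (\<Sum>i<n. (nat \<bar>int (completion S i) - int (r i)\<bar>)\<^sup>2)" for S
  have g: "sq_flow n r S = real (g S)" for S
    by (simp add: sq_flow_def g_def flow_def)
  obtain S where "feasible n r p S"
    using fcfs_exists[OF assms] unfolding fcfs_def by blast
  then have "is_arg_min g (feasible n r p) (arg_min g (feasible n r p))"
    using arg_min_natI[of "feasible n r p" S g] arg_min_nat_le[of "feasible n r p" _ g]
    unfolding is_arg_min_linorder by blast
  then show ?thesis unfolding optimal_def is_arg_min_def g by auto
qed

end

theory Submission
  imports Defs
begin

text \<open>A squared flow time counts the pairs \<open>(s, t)\<close> for which the job is released by \<open>min s t\<close> and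
  unfinished at \<open>max s t\<close>. Hence it suffices to bound, for all \<open>u\<close> and \<open>v\<close>, the number of jobs
  released by \<open>u\<close> and unfinished at \<open>v\<close>. First-Come-First-Served gives the jobs released by \<open>u\<close>
  priority over all others and never idles on them, so it has at most as much of their work left at
  \<open>v\<close> as any other schedule. At most one unfinished job is partially processed, so the comparison
  of the remaining work carries over to the number of jobs, with factor \<open>K + 1\<close>.\<close>

section \<open>Pending jobs and processed work in a feasible schedule\<close>

definition pending :: "nat \<Rightarrow> (nat \<Rightarrow> nat) \<Rightarrow> schedule \<Rightarrow> nat \<Rightarrow> nat \<Rightarrow> nat set" where
  "pending n r S u v = {i. i < n \<and> r i \<le> u \<and> v < completion S i}"

definition work_done :: "schedule \<Rightarrow> nat \<Rightarrow> nat \<Rightarrow> nat" where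
  "work_done S t i = card (slots S i \<inter> {..<t})"

definition work_left :: "schedule \<Rightarrow> nat \<Rightarrow> nat \<Rightarrow> nat" where
  "work_left S t i = card (slots S i \<inter> {t..})"

lemma finite_pending [simp]: "finite (pending n r S u v)"
  by (simp add: pending_def)

lemma work_done_Suc: "work_done S (Suc t) i = work_done S t i + (if S t = Some i then 1 else 0)"
proof (cases "S t = Some i")
  case True
  then have "slots S i \<inter> {..<Suc t} = insert t (slots S i \<inter> {..<t})"
    by (auto simp: slots_def)
  then show ?thesis using True by (simp add: work_done_def)
next
  case False
  then have "slots S i \<inter> {..<Suc t} = slots S i \<inter> {..<t}"
    by (auto simp: slots_def less_Suc_eq)
  then show ?thesis using False by (simp add: work_done_def)
qed

context
  fixes n :: nat and r p :: "nat \<Rightarrow> nat" and S :: schedule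
  assumes valid: "valid_instance n p" and feas: "feasible n r p S"
begin

lemma card_slots: "i < n \<Longrightarrow> card (slots S i) = p i"
  using feas by (simp add: feasible_def)

lemma card_slots_pos: "i < n \<Longrightarrow> 0 < card (slots S i)"
  using valid card_slots[of i] by (fastforce simp: valid_instance_def)

lemma finite_slots: "i < n \<Longrightarrow> finite (slots S i)"
  using card_slots_pos card_gt_0_iff by blast

lemma slot_less_completion: "i < n \<Longrightarrow> t \<in> slots S i \<Longrightarrow> t < completion S i"
  using finite_slots by (simp add: completion_def less_Suc_eq_le)

lemma last_slot:
  assumes "i < n"
  obtains t where "t \<in> slots S i" "completion S i = Suc t"
proof
  show "Max (slots S i) \<in> slots S i"
    using card_slots_pos[OF assms] by (intro Max_in) (auto simp: card_gt_0_iff)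
qed (simp add: completion_def)

lemma release_le_completion:
  assumes "i < n"
  shows "r i \<le> completion S i"
proof -
  obtain t where "t \<in> slots S i" "completion S i = Suc t"
    using last_slot[OF assms] .
  then show ?thesis using feas by (fastforce simp: feasible_def slots_def)
qed

lemma work_done_le:
  assumes "i < n"
  shows "work_done S t i \<le> p i"
  using card_mono[OF finite_slots[OF assms], of "slots S i \<inter> {..<t}"] card_slots[OF assms]
  by (simp add: work_done_def)

lemma work_done_completed:
  assumes "i < n" "completion S i \<le> t"
  shows "work_done S t i = p i"
proof -
  have "slots S i \<inter> {..<t} = slots S i"
    using slot_less_completion[OF assms(1)] assms(2) by fastforce
  then show ?thesis using card_slots[OF assms(1)] by (simp add: work_done_def)
qed

lemma work_done_before_release:
  assumes "t \<le> r i"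
  shows "work_done S t i = 0"
proof -
  have "slots S i \<inter> {..<t} = {}"
    using feas assms by (fastforce simp: feasible_def slots_def)
  then show ?thesis by (simp add: work_done_def)
qed

lemma work_done_plus_left:
  assumes "i < n"
  shows "work_done S t i + work_left S t i = p i"
proof -
  have "card (slots S i) = card (slots S i \<inter> {..<t} \<union> slots S i \<inter> {t..})"
    by (rule arg_cong[where f = card]) auto
  also have "\<dots> = work_done S t i + work_left S t i"
    unfolding work_done_def work_left_def
    by (rule card_Un_disjoint) (use finite_slots[OF assms] in auto)
  finally show ?thesis using card_slots[OF assms] by simp
qed

lemma work_left_pos_iff:
  assumes "i < n"
  shows "0 < work_left S t i \<longleftrightarrow> t < completion S i"
proof
  assume "0 < work_left S t i"
  then obtain x where "x \<in> slots S i" "t \<le> x"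
    by (auto simp: work_left_def card_gt_0_iff)
  then show "t < completion S i" using slot_less_completion[OF assms] by fastforce
next
  assume *: "t < completion S i"
  obtain x where "x \<in> slots S i" "completion S i = Suc x"
    using last_slot[OF assms] .
  then have "x \<in> slots S i \<inter> {t..}" using * by auto
  then show "0 < work_left S t i"
    using finite_slots[OF assms] by (auto simp: work_left_def card_gt_0_iff)
qed

text \<open>Completed jobs have no work left, so only pending jobs contribute, each at most its
  processing time.\<close>

lemma sum_work_left_le:
  assumes "\<And>i. i < n \<Longrightarrow> p i \<le> b"
  shows "(\<Sum>i | i < n \<and> r i \<le> u. work_left S v i) \<le> b * card (pending n r S u v)"
proof -
  have "(\<Sum>i | i < n \<and> r i \<le> u. work_left S v i) = (\<Sum>i\<in>pending n r S u v. work_left S v i)"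
    by (rule sum.mono_neutral_right) (use work_left_pos_iff in \<open>auto simp: pending_def\<close>)
  also have "\<dots> \<le> (\<Sum>i\<in>pending n r S u v. b)"
  proof (rule sum_mono)
    fix i assume "i \<in> pending n r S u v"
    then have "i < n" by (simp add: pending_def)
    then show "work_left S v i \<le> b"
      using work_done_plus_left[of i v] assms[of i] by linarith
  qed
  finally show ?thesis by (simp add: mult.commute)
qed

text \<open>The selected pairs form the square of \<open>{r i..<completion S i}\<close>, whose
  cardinality is the squared length; \<open>M\<close> makes the grid large enough to contain
  it.\<close>

lemma flow_square_eq:
  assumes "i < n" "completion S i \<le> M"
  shows "(flow r S i)\<^sup>2 =
    (\<Sum>(s, t)\<in>{..<M} \<times> {..<M}. of_bool (r i \<le> min s t \<and> max s t < completion S i))"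
proof -
  let ?I = "{r i..<completion S i}"
  have "(\<Sum>(s, t)\<in>{..<M} \<times> {..<M}. of_bool (r i \<le> min s t \<and> max s t < completion S i)) =
      (\<Sum>x\<in>{..<M} \<times> {..<M}. of_bool (x \<in> ?I \<times> ?I) :: real)"
    by (rule sum.cong) auto
  also have "\<dots> = real (card ({..<M} \<times> {..<M} \<inter> ?I \<times> ?I))"
    by (simp add: Int_def)
  also have "{..<M} \<times> {..<M} \<inter> ?I \<times> ?I = ?I \<times> ?I"
    using assms(2) by auto
  finally show ?thesis
    using release_le_completion[OF assms(1)]
    by (simp add: card_cartesian_product flow_def power2_eq_square of_nat_diff)
qed

text \<open>Swapping the sums over jobs and pairs turns the indicators into counts, so that two
  schedules can be compared pair by pair.\<close>

lemma sq_flow_eq_sum_pending: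
  assumes "\<And>i. i < n \<Longrightarrow> completion S i \<le> M"
  shows "sq_flow n r S =
    (\<Sum>(s, t)\<in>{..<M} \<times> {..<M}. real (card (pending n r S (min s t) (max s t))))"
proof -
  have "sq_flow n r S = (\<Sum>i<n. \<Sum>(s, t)\<in>{..<M} \<times> {..<M}.
      of_bool (r i \<le> min s t \<and> max s t < completion S i))"
    unfolding sq_flow_def using assms by (intro sum.cong refl flow_square_eq) auto
  also have "\<dots> = (\<Sum>x\<in>{..<M} \<times> {..<M}. \<Sum>i<n.
      of_bool (r i \<le> min (fst x) (snd x) \<and> max (fst x) (snd x) < completion S i))"
    unfolding case_prod_unfold by (rule sum.swap)
  also have "\<dots> = (\<Sum>x\<in>{..<M} \<times> {..<M}.
      real (card (pending n r S (min (fst x) (snd x)) (max (fst x) (snd x)))))"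
  proof (rule sum.cong[OF refl])
    fix x :: "nat \<times> nat"
    have "{..<n} \<inter> {i. r i \<le> u \<and> v < completion S i} = pending n r S u v" for u v
      by (auto simp: pending_def)
    then show "(\<Sum>i<n. of_bool (r i \<le> min (fst x) (snd x) \<and> max (fst x) (snd x) < completion S i)) =
        real (card (pending n r S (min (fst x) (snd x)) (max (fst x) (snd x))))"
      by (simp only: sum_of_bool_eq finite_lessThan)
  qed
  finally show ?thesis unfolding case_prod_unfold .
qed

end

section \<open>First-Come-First-Served against an arbitrary feasible schedule\<close>

context
  fixes n :: nat and r p :: "nat \<Rightarrow> nat" and S :: schedule
  assumes valid: "valid_instance n p" and fcfs: "fcfs n r p S"
begin

lemma fcfs_feasible: "feasible n r p S"
  using fcfs by (simp add: fcfs_def)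

text \<open>The pending job \<open>i\<close> rules out idling at \<open>t\<close>. A job released
  strictly after \<open>i\<close> cannot run there, as it must wait for the last slot of
  \<open>i\<close>, which is not before \<open>t\<close>. The premise \<open>r i \<le> t\<close> is
  separate because \<open>u\<close> may exceed \<open>t\<close>.\<close>

lemma fcfs_serves_pending:
  assumes "i \<in> pending n r S u t" "r i \<le> t"
  obtains j where "S t = Some j" "j < n" "r j \<le> u"
proof -
  have i: "i < n" "r i \<le> u" "t < completion S i"
    using assms(1) by (auto simp: pending_def)
  have "S t \<noteq> None"
    using fcfs i assms(2) unfolding fcfs_def by blast
  then obtain j where j: "S t = Some j" by blast
  then have "j < n" using fcfs_feasible by (auto simp: feasible_def)
  obtain x where x: "x \<in> slots S i" "completion S i = Suc x"
    using last_slot[OF valid fcfs_feasible i(1)] .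
  have "\<not> r i < r j"
  proof
    assume "r i < r j"
    moreover have "t \<in> slots S j" using j by (simp add: slots_def)
    ultimately have "x < t"
      using fcfs i(1) \<open>j < n\<close> x(1) unfolding fcfs_def by blast
    then show False using x(2) i(3) by simp
  qed
  then show ?thesis using that[of j] j \<open>j < n\<close> i(2) by simp
qed

text \<open>Induction over slots: if \<open>S\<close> serves a job released by \<open>u\<close> in
  slot \<open>t\<close>, it gains one unit and \<open>T\<close> gains at most one.\<close>

lemma fcfs_work_done_max:
  assumes feasT: "feasible n r p T"
  shows "(\<Sum>i | i < n \<and> r i \<le> u. work_done T t i) \<le> (\<Sum>i | i < n \<and> r i \<le> u. work_done S t i)"
proof (induction t)
  case 0
  then show ?case by (simp add: work_done_def)
next
  case (Suc t)
  let ?A = "{i. i < n \<and> r i \<le> u}"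
  show ?case
  proof (cases "\<exists>j\<in>?A. S t = Some j")
    case True
    then obtain j where j: "j \<in> ?A" "S t = Some j" by blast
    have "(\<Sum>i\<in>?A. if T t = Some i then 1 else 0) \<le> (1::nat)"
      by (cases "T t") auto
    moreover have "(\<Sum>i\<in>?A. if S t = Some i then 1 else 0) = (1::nat)"
      using j by simp
    ultimately show ?thesis using Suc.IH by (simp add: work_done_Suc sum.distrib)
  next
    case False
    \<comment> \<open>Here the bound holds job by job: a job released by \<open>t\<close> is already
      finished in \<open>S\<close>, and a job released later has received nothing in
      \<open>T\<close>.\<close>
    show ?thesis
    proof (rule sum_mono)
      fix i assume i: "i \<in> ?A"
      show "work_done T (Suc t) i \<le> work_done S (Suc t) i"
      proof (cases "r i \<le> t")
        case True
        have "i \<notin> pending n r S u t"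
        proof
          assume "i \<in> pending n r S u t"
          then show False
            by (rule fcfs_serves_pending[OF _ True]) (use False in auto)
        qed
        then have "completion S i \<le> Suc t" using i by (auto simp: pending_def)
        then show ?thesis
          using i work_done_completed[OF valid fcfs_feasible, of i "Suc t"]
            work_done_le[OF valid feasT, of i "Suc t"] by simp
      next
        case False
        then show ?thesis
          using work_done_before_release[OF valid feasT, of "Suc t" i] by simp
      qed
    qed
  qed
qed

text \<open>Work done and work left add up to the same total in every feasible schedule, so maximal
  work done means minimal work left.\<close>

lemma fcfs_work_left_min:
  assumes feasT: "feasible n r p T"
  shows "(\<Sum>i | i < n \<and> r i \<le> u. work_left S t i) \<le> (\<Sum>i | i < n \<and> r i \<le> u. work_left T t i)"
proof -
  have *: "(\<Sum>i | i < n \<and> r i \<le> u. work_done X t i) + (\<Sum>i | i < n \<and> r i \<le> u. work_left X t i) =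
      (\<Sum>i | i < n \<and> r i \<le> u. p i)" if "feasible n r p X" for X
    unfolding sum.distrib[symmetric]
    by (rule sum.cong) (use work_done_plus_left[OF valid that] in auto)
  show ?thesis
    using *[OF fcfs_feasible] *[OF feasT] fcfs_work_done_max[OF feasT, where u = u and t = t] by linarith
qed

text \<open>Without preemption, a job started before \<open>v\<close> and unfinished at
  \<open>v\<close> occupies slot \<open>v - 1\<close>, which holds one job only.\<close>

lemma fcfs_partial_at_most_one:
  assumes "i < n" "j < n" "v < completion S i" "v < completion S j"
    and "work_done S v i \<noteq> 0" "work_done S v j \<noteq> 0"
  shows "i = j"
proof -
  have run: "0 < v \<and> S (v - 1) = Some k"
    if k: "k < n" "v < completion S k" "work_done S v k \<noteq> 0" for k
  proof -
    have "\<forall>i<n. \<exists>s. slots S i = {s..<s + p i}"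
      using fcfs unfolding fcfs_def by (elim conjE)
    then obtain s where s: "slots S k = {s..<s + p k}"
      using k(1) by blast
    obtain x where x: "x \<in> slots S k" "completion S k = Suc x"
      using last_slot[OF valid fcfs_feasible k(1)] .
    have "slots S k \<inter> {..<v} \<noteq> {}"
      using k(3) by (metis work_done_def card.empty)
    then obtain y where y: "y \<in> slots S k" "y < v" by blast
    \<comment> \<open>The slots \<open>y < v\<close> and \<open>x \<ge> v\<close> lie in one
      interval, hence so does \<open>v - 1\<close>; \<open>0 < v\<close> keeps the subtraction from
      truncating.\<close>
    have "0 < v" "v - 1 \<in> slots S k" using x y k(2) unfolding s by auto
    then show ?thesis by (simp add: slots_def)
  qed
  have "Some i = Some j"
    using run[OF assms(1,3,5)] run[OF assms(2,4,6)] by metis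
  then show ?thesis by simp
qed

text \<open>Apart from at most one partially processed job, every pending job is untouched and still
  needs at least \<open>a\<close> units.\<close>

lemma fcfs_sum_work_left_ge:
  assumes "\<And>i. i < n \<Longrightarrow> a \<le> p i"
  shows "a * (card (pending n r S u v) - 1) \<le> (\<Sum>i | i < n \<and> r i \<le> u. work_left S v i)"
proof -
  define Q where "Q = {i \<in> pending n r S u v. work_done S v i \<noteq> 0}"
  have "i = j" if "i \<in> Q" "j \<in> Q" for i j
    by (rule fcfs_partial_at_most_one[of i j v]) (use that in \<open>auto simp: Q_def pending_def\<close>)
  then have "card Q \<le> 1"
    using card_le_Suc0_iff_eq[of Q] by (simp add: Q_def)
  then have "card (pending n r S u v) - 1 \<le> card (pending n r S u v - Q)"
    using diff_card_le_card_Diff[of Q "pending n r S u v"] by (simp add: Q_def)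
  then have "a * (card (pending n r S u v) - 1) \<le> (\<Sum>i\<in>pending n r S u v - Q. a)"
    by (simp add: mult.commute)
  also have "\<dots> \<le> (\<Sum>i\<in>pending n r S u v - Q. work_left S v i)"
  proof (rule sum_mono)
    fix i assume "i \<in> pending n r S u v - Q"
    then have "i < n" "work_done S v i = 0" by (auto simp: Q_def pending_def)
    then show "a \<le> work_left S v i"
      using work_done_plus_left[OF valid fcfs_feasible, of i v] assms[of i] by simp
  qed
  also have "\<dots> \<le> (\<Sum>i | i < n \<and> r i \<le> u. work_left S v i)"
    by (rule sum_mono2) (auto simp: pending_def)
  finally show ?thesis .
qed

text \<open>The chain \<open>a * (N - 1) \<le>\<close> work left in \<open>S\<close>
  \<open>\<le>\<close> work left in \<open>T\<close> \<open>\<le> b * N'\<close>, together with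
  \<open>b \<le> K * a\<close>, gives \<open>N \<le> K * N' + 1\<close> for nonempty pending sets.
  The extra 1 is absorbed by \<open>N' \<ge> 1\<close>.\<close>

lemma fcfs_card_pending_le:
  assumes feasT: "feasible n r p T" and K: "proc_ratio n p \<le> K"
  shows "real (card (pending n r S u v)) \<le> (K + 1) * real (card (pending n r T u v))"
proof -
  define a where "a = Min (p ` {..<n})"
  define b where "b = Max (p ` {..<n})"
  define N where "N = card (pending n r S u v)"
  define N' where "N' = card (pending n r T u v)"
  have n: "n \<ge> 1" using valid by (simp add: valid_instance_def)
  then have ne: "p ` {..<n} \<noteq> {}" by (simp add: lessThan_empty_iff)
  have a: "a \<le> p i" and b: "p i \<le> b" if "i < n" for i
    using that by (auto simp: a_def b_def)
  have "a \<in> p ` {..<n}" unfolding a_def by (rule Min_in) (use ne in auto)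
  then have "a \<ge> 1" using valid by (auto simp: valid_instance_def)
  then have bK: "real b \<le> K * real a"
    using K by (simp add: proc_ratio_def a_def b_def field_simps)
  \<comment> \<open>The sign of \<open>K\<close> comes from the ratio bound; it settles the case of
    no pending jobs in \<open>S\<close>.\<close>
  then have "0 \<le> K * real a" using of_nat_0_le_iff[of b] by linarith
  then have "K \<ge> 0" using \<open>a \<ge> 1\<close> by (simp add: zero_le_mult_iff)
  have left: "(\<Sum>i | i < n \<and> r i \<le> u. work_left S v i) \<le> b * N'"
    using fcfs_work_left_min[OF feasT, where u = u and t = v]
      sum_work_left_le[OF valid feasT b, where u = u and v = v]
    by (simp add: N'_def)
  show ?thesis
  proof (cases "pending n r S u v = {}")
    case True
    then show ?thesis using \<open>K \<ge> 0\<close> by simp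
  next
    case False
    then obtain i where i: "i < n" "r i \<le> u" "v < completion S i" by (auto simp: pending_def)
    \<comment> \<open>A job pending in \<open>S\<close> has positive work left, which forces
      \<open>b * N'\<close> to be positive.\<close>
    have "work_left S v i \<le> (\<Sum>i | i < n \<and> r i \<le> u. work_left S v i)"
      by (rule member_le_sum) (use i in auto)
    then have "N' \<ge> 1"
      using left work_left_pos_iff[OF valid fcfs_feasible i(1), of v] i(3) by (cases N') auto
    have "N \<ge> 1" using False by (simp add: N_def Suc_le_eq card_gt_0_iff)
    have "a * (N - 1) \<le> b * N'"
      using fcfs_sum_work_left_ge[OF a, where u = u and v = v] left by (simp add: N_def)
    then have "real a * (real N - 1) \<le> real b * real N'"
      using \<open>N \<ge> 1\<close> by (metis of_nat_1 of_nat_diff of_nat_le_iff of_nat_mult)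
    also have "\<dots> \<le> K * real a * real N'"
      by (rule mult_right_mono[OF bK]) simp
    finally have "real a * (real N - 1) \<le> real a * (K * real N')"
      by (simp add: mult_ac)
    then have "real N - 1 \<le> K * real N'" using \<open>a \<ge> 1\<close> by simp
    then show ?thesis using \<open>N' \<ge> 1\<close> by (simp add: N_def N'_def algebra_simps)
  qed
qed

lemma fcfs_sq_flow_le:
  assumes feasT: "feasible n r p T" and K: "proc_ratio n p \<le> K"
  shows "sq_flow n r S \<le> (K + 1) * sq_flow n r T"
proof -
  \<comment> \<open>A crude common bound on all completion times, so that both sums range over one
    grid.\<close>
  define M where "M = (\<Sum>i<n. completion S i + completion T i)"
  have M: "completion S i + completion T i \<le> M" if "i < n" for i
    unfolding M_def by (rule member_le_sum) (use that in auto)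
  have "sq_flow n r S =
      (\<Sum>(s, t)\<in>{..<M} \<times> {..<M}. real (card (pending n r S (min s t) (max s t))))"
    by (rule sq_flow_eq_sum_pending[OF valid fcfs_feasible]) (use M in fastforce)
  also have "\<dots> \<le>
      (\<Sum>(s, t)\<in>{..<M} \<times> {..<M}. (K + 1) * real (card (pending n r T (min s t) (max s t))))"
    unfolding case_prod_unfold by (rule sum_mono) (rule fcfs_card_pending_le[OF feasT K])
  also have "\<dots> = (K + 1) *
      (\<Sum>(s, t)\<in>{..<M} \<times> {..<M}. real (card (pending n r T (min s t) (max s t))))"
    unfolding case_prod_unfold by (rule sum_distrib_left[symmetric])
  also have "(\<Sum>(s, t)\<in>{..<M} \<times> {..<M}. real (card (pending n r T (min s t) (max s t)))) =
      sq_flow n r T"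
    by (rule sq_flow_eq_sum_pending[OF valid feasT, symmetric]) (use M in fastforce)
  finally show ?thesis .
qed

end

theorem theoremE1:
  fixes K :: real
  assumes "K \<ge> 1"
  shows "\<exists>C::real. \<forall>n r p S Opt.
           valid_instance n p \<and> proc_ratio n p \<le> K \<and>
           fcfs n r p S \<and> optimal n r p Opt \<longrightarrow>
           sqrt (sq_flow n r S) \<le> C * sqrt (sq_flow n r Opt)"
proof (intro exI[of _ "sqrt (K + 1)"] allI impI)
  fix n r p S Opt
  assume *: "valid_instance n p \<and> proc_ratio n p \<le> K \<and> fcfs n r p S \<and> optimal n r p Opt"
  then have "feasible n r p Opt" by (simp add: optimal_def is_arg_min_def)
  then have "sq_flow n r S \<le> (K + 1) * sq_flow n r Opt"
    using fcfs_sq_flow_le * by blast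
  \<comment> \<open>Taking roots turns the factor \<open>K + 1\<close> into
    \<open>sqrt (K + 1)\<close>.\<close>
  then show "sqrt (sq_flow n r S) \<le> sqrt (K + 1) * sqrt (sq_flow n r Opt)"
    by (simp flip: real_sqrt_mult)
qed

end
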